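(* If $a,b,\lambda,u$ are non-negative real numbers with $u+\lambda=1$, then $a^{\lambda}b^{u}\le \lambda a+u b$.
   Context: Where the expression $0^0$ occurs, it is interpreted as $1$. *)

theory Defs
  imports Complex_Main
begin

(* The library has 0 powr 0 = 0, whereas here 0^0 is read as 1. For all other
   non-negative bases and exponents powr is the usual real power. *)
definition rpow :: "real \<Rightarrow> real \<Rightarrow> real" where
  "rpow x y = (if x = 0 \<and> y = 0 then 1 else x powr y)"

end

theory Submission
  imports Defs "HOL-Analysis.Convex"
begin

text \<open>For positive \<open>a\<close> and \<open>b\<close> this is weighted AM-GM, i.e.
  concavity of \<open>ln\<close>: \<open>lam * ln a + u * ln b\<close> is at most
  \<open>ln (lam * a + u * b)\<close>.\<close>

theorem lemma2p1:
  fixes a b lam u :: real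
  assumes "a \<ge> 0" and "b \<ge> 0" and "lam \<ge> 0" and "u \<ge> 0"
    and "u + lam = 1"
  shows "rpow a lam * rpow b u \<le> lam * a + u * b"
proof (cases "a = 0 \<or> b = 0 \<or> lam = 0 \<or> u = 0")
  case True
  then show ?thesis
    \<comment> \<open>A zero exponent forces the other to be 1, giving equality even at a zero base
      since \<open>rpow 0 0 = 1\<close>. Otherwise a zero base makes the left side 0.\<close>
    using assms by (auto simp: rpow_def)
next
  case False
  then show ?thesis
    \<comment> \<open>Both bases are now positive, so \<open>rpow\<close> agrees with
      \<open>powr\<close>.\<close>
    using Youngs_inequality_0[of lam u a b] assms by (simp add: rpow_def add.commute)
qed

end
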